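(* Let $n\ge3$, $\varepsilon\in\{-1,1\}$, and let $\varphi$ be a $\frac12$-derivation of the Lie algebra $\mathfrak{r}_{2n+1}(2-n,\varepsilon)$. Then there are complex numbers $a,b,c$ such that $$\varphi(e_i)=ae_i\ (1\le i\le 2n,\ i\ne2),\quad \varphi(e_2)=ae_2+be_{2n},\quad \varphi(x)=(3-2n)be_{2n-1}+ce_{2n}+ax.$$
   Context: All algebras are over $\mathbb{C}$. A $\frac12$-derivation of a Lie algebra $(\mathfrak{L},[-,-])$ is a linear map $\varphi:\mathfrak{L}\to\mathfrak{L}$ with $\varphi([u,v])=\frac12([\varphi(u),v]+[u,\varphi(v)])$ for all $u,v\in\mathfrak{L}$. $\mathfrak{r}_{2n+1}(2-n,\varepsilon)$ is the $(2n+1)$-dimensional Lie algebra with basis $e_1,\dots,e_{2n},x$ and brackets $[e_i,e_1]=e_{i+1}$ for $2\le i\le 2n-2$; $[e_i,e_{2n+1-i}]=(-1)^ie_{2n}$ for $2\le i\le n$; $[e_1,x]=e_1+\varepsilon e_{2n}$; $[e_i,x]=(i-n)e_i$ for $2\le i\le 2n-1$; $[e_{2n},x]=e_{2n}$; brackets of basis elements not determined by these and antisymmetry are zero. *)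

theory Defs
  imports "HOL-Analysis.Cartesian_Space"
begin

locale complex_lie_algebra = vector_space smul
  for smul :: "complex \<Rightarrow> 'a::ab_group_add \<Rightarrow> 'a" (infixr "*\<^sub>C" 75) +
  fixes bracket :: "'a \<Rightarrow> 'a \<Rightarrow> 'a"
  assumes linear_left: "Vector_Spaces.linear smul smul (\<lambda>u. bracket u v)"
    and linear_right: "Vector_Spaces.linear smul smul (\<lambda>v. bracket u v)"
    and bracket_self: "bracket u u = 0"
    and jacobi: "bracket (bracket u v) w + bracket (bracket v w) u + bracket (bracket w u) v = 0"

definition half_derivation ::
  "(complex \<Rightarrow> 'a \<Rightarrow> 'a) \<Rightarrow> ('a \<Rightarrow> 'a \<Rightarrow> 'a) \<Rightarrow> ('a::ab_group_add \<Rightarrow> 'a) \<Rightarrow> bool" where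
  "half_derivation smul bracket \<phi> \<longleftrightarrow>
     Vector_Spaces.linear smul smul \<phi> \<and>
     (\<forall>u v. \<phi> (bracket u v) = smul (1/2) (bracket (\<phi> u) v + bracket u (\<phi> v)))"

text \<open>
  The pairs of indices whose bracket of the corresponding vectors \<open>e\<^sub>i, e\<^sub>j\<close> is
  prescribed; up to antisymmetry, all other brackets of the \<open>e\<^sub>i\<close> vanish.
\<close>

definition prescribed_pairs :: "nat \<Rightarrow> (nat \<times> nat) set" where
  "prescribed_pairs n = {(i, 1) |i. i \<in> {2..2*n-2}} \<union> {(i, 2*n+1-i) |i. i \<in> {2..n}}"

text \<open>
  \<open>r_algebra smul bracket n \<epsilon> e x\<close> says that the whole type is the Lie algebra
  \<open>\<rr>\<^bsub>2n+1\<^esub>(2-n, \<epsilon>)\<close> presented by the basis \<open>e 1, \<dots>, e (2*n), x\<close>.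
  Values of \<open>e\<close> outside \<open>{1..2*n}\<close> are irrelevant.
\<close>

locale r_algebra = complex_lie_algebra smul bracket
  for smul :: "complex \<Rightarrow> 'a::ab_group_add \<Rightarrow> 'a" (infixr "*\<^sub>C" 75)
    and bracket :: "'a \<Rightarrow> 'a \<Rightarrow> 'a" +
  fixes n :: nat and \<epsilon> :: complex and e :: "nat \<Rightarrow> 'a" and x :: 'a
  assumes inj_e: "inj_on e {1..2*n}"
    and x_notin: "x \<notin> e ` {1..2*n}"
    and independent_basis: "independent (insert x (e ` {1..2*n}))"
    and span_basis: "span (insert x (e ` {1..2*n})) = UNIV"
    and bracket_e_e1: "i \<in> {2..2*n-2} \<Longrightarrow> bracket (e i) (e 1) = e (i + 1)"
    and bracket_e_e: "i \<in> {2..n} \<Longrightarrow> bracket (e i) (e (2*n+1-i)) = (-1) ^ i *\<^sub>C e (2*n)"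
    and bracket_e1_x: "bracket (e 1) x = e 1 + \<epsilon> *\<^sub>C e (2*n)"
    and bracket_e_x: "i \<in> {2..2*n-1} \<Longrightarrow> bracket (e i) x = (of_nat i - of_nat n) *\<^sub>C e i"
    and bracket_e2n_x: "bracket (e (2*n)) x = e (2*n)"
    and bracket_zero: "\<lbrakk>i \<in> {1..2*n}; j \<in> {1..2*n};
      (i, j) \<notin> prescribed_pairs n; (j, i) \<notin> prescribed_pairs n\<rbrakk> \<Longrightarrow> bracket (e i) (e j) = 0"

text \<open>
  The presentation is consistent: the rest of the theory realises the algebra on
  \<open>\<complex>\<^bsup>2n+1\<^esup>\<close> (lemma \<open>r_algebra_exists\<close>).
\<close>

context
  fixes n :: nat and \<epsilon> :: complex
  assumes n: "n \<ge> 2"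
begin

private definition alt :: "(nat \<Rightarrow> complex) \<Rightarrow> (nat \<Rightarrow> complex) \<Rightarrow> nat \<Rightarrow> nat \<Rightarrow> complex" where
  "alt u v i j = u i * v j - u j * v i"

private definition omega :: "(nat \<Rightarrow> complex) \<Rightarrow> (nat \<Rightarrow> complex) \<Rightarrow> complex" where
  "omega u v = (\<Sum>i = 2..2*n-1. (-1) ^ i * u i * v (2*n+1-i))"

private definition br :: "(nat \<Rightarrow> complex) \<Rightarrow> (nat \<Rightarrow> complex) \<Rightarrow> nat \<Rightarrow> complex" where
  "br u v k =
    (if k = 1 then alt u v 1 (2*n+1)
     else if k \<in> {2..2*n-1} then
       (if k = 2 then 0 else alt u v (k-1) 1) + (of_nat k - of_nat n) * alt u v k (2*n+1)
     else if k = 2*n then omega u v + \<epsilon> * alt u v 1 (2*n+1) + alt u v (2*n) (2*n+1)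
     else 0)"

private definition tt :: "(nat \<Rightarrow> complex) \<Rightarrow> (nat \<Rightarrow> complex) \<Rightarrow> complex" where
  "tt u v = (\<Sum>i = 3..2*n-1. (-1) ^ i * u (i-1) * v (2*n+1-i))"

private definition ww :: "(nat \<Rightarrow> complex) \<Rightarrow> (nat \<Rightarrow> complex) \<Rightarrow> complex" where
  "ww u v = (\<Sum>i = 2..2*n-1. (of_nat i - of_nat n) * (-1) ^ i * u i * v (2*n+1-i))"

private lemma neg_one_reflect:
  fixes i m :: nat
  assumes "i \<le> m"
  shows "(-1) ^ (m - i) = (-1 :: complex) ^ m * (-1) ^ i"
  using assms by (metis (no_types, opaque_lifting) add.commute le_add_diff_inverse2 minus_one_power_iff
      mult.right_neutral mult_minus1_right even_diff_nat even_add mult_minus_left mult_1 minus_minus linorder_not_less)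

private lemma tt_commute: "tt u v = tt v u"
  unfolding tt_def
proof (rule sum.reindex_bij_witness[of _ "\<lambda>i. 2*n+2-i" "\<lambda>i. 2*n+2-i"])
  fix i assume i: "i \<in> {3..2*n-1}"
  have "(-1) ^ (2*n+2-i) = (-1 :: complex) ^ i"
    using i by (subst neg_one_reflect) auto
  moreover have "2*n+2-i-1 = 2*n+1-i" "2*n+1-(2*n+2-i) = i-1" using i by auto
  ultimately show "(-1) ^ (2*n+2-i) * v (2*n+2-i-1) * u (2*n+1-(2*n+2-i)) =
      (-1) ^ i * u (i-1) * v (2*n+1-i)" by simp
qed auto

private lemma reflect_sum:
  fixes f :: "nat \<Rightarrow> complex"
  shows "(\<Sum>i = 2..2*n-1. f i) = (\<Sum>i = 2..2*n-1. f (2*n+1-i))"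
  by (rule sum.reindex_bij_witness[of _ "\<lambda>i. 2*n+1-i" "\<lambda>i. 2*n+1-i"]) auto

private lemma ww_diff: "ww u v = ww v u + omega u v"
proof -
  have "ww v u = (\<Sum>i = 2..2*n-1. - ((of_nat n + 1 - of_nat i) * (-1) ^ i * u i * v (2*n+1-i)))"
    unfolding ww_def
    by (subst reflect_sum, rule sum.cong) (auto simp: neg_one_reflect of_nat_diff algebra_simps)
  then show ?thesis
    unfolding ww_def omega_def by (simp add: sum.distrib[symmetric] algebra_simps)
qed

private lemma omega_swap: "omega u v = - omega v u"
  using ww_diff[of u v] ww_diff[of v u] by (simp add: eq_neg_iff_add_eq_0 add.commute)

private lemma omega_br:
  "omega (br u v) w = v 1 * tt u w - u 1 * tt v w + v (2*n+1) * ww u w - u (2*n+1) * ww v w"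
proof -
  have split: "{2..2*n-1} = insert 2 {3..2*n-1}" using n by auto
  have "omega (br u v) w = (\<Sum>i = 2..2*n-1. (-1) ^ i * (if i = 2 then 0 else alt u v (i-1) 1) * w (2*n+1-i))
     + (\<Sum>i = 2..2*n-1. (-1) ^ i * (of_nat i - of_nat n) * alt u v i (2*n+1) * w (2*n+1-i))"
    unfolding omega_def sum.distrib[symmetric]
    by (rule sum.cong) (auto simp: br_def algebra_simps)
  also have "(\<Sum>i = 2..2*n-1. (-1) ^ i * (if i = 2 then 0 else alt u v (i-1) 1) * w (2*n+1-i))
     = (\<Sum>i = 3..2*n-1. (-1) ^ i * alt u v (i-1) 1 * w (2*n+1-i))"
    unfolding split by (subst sum.insert) (auto intro!: sum.cong)
  also have "\<dots> = v 1 * tt u w - u 1 * tt v w"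
    unfolding tt_def sum_distrib_left sum_subtractf[symmetric] alt_def
    by (rule sum.cong) (auto simp: algebra_simps)
  also have "(\<Sum>i = 2..2*n-1. (-1) ^ i * (of_nat i - of_nat n) * alt u v i (2*n+1) * w (2*n+1-i))
     = v (2*n+1) * ww u w - u (2*n+1) * ww v w"
    unfolding ww_def sum_distrib_left sum_subtractf[symmetric] alt_def
    by (rule sum.cong) (auto simp: algebra_simps)
  finally show ?thesis by (simp add: algebra_simps)
qed

private lemma br_jacobi: "br (br u v) w k + br (br v w) u k + br (br w u) v k = 0"
proof -
  have br1: "br u v 1 = alt u v 1 (2*n+1)" and brx: "br u v (2*n+1) = 0" for u v
    using n by (auto simp: br_def)
  have br2: "br u v 2 = (2 - of_nat n) * alt u v 2 (2*n+1)" for u v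
    using n by (auto simp: br_def)
  have br3: "br u v k = alt u v (k-1) 1 + (of_nat k - of_nat n) * alt u v k (2*n+1)"
    if "k \<in> {3..2*n-1}" for u v k using that by (auto simp: br_def)
  have br2n: "br u v (2*n) = omega u v + \<epsilon> * alt u v 1 (2*n+1) + alt u v (2*n) (2*n+1)" for u v
    using n by (auto simp: br_def)
  consider "k = 1" | "k = 2" | "k = 3" "k \<in> {3..2*n-1}" | "k \<in> {4..2*n-1}" | "k = 2*n"
    | "k = 0 \<or> k > 2*n" using n by fastforce
  then show ?thesis
  proof cases
    case 1
    then show ?thesis
      by (simp only: br1 alt_def brx) (simp add: algebra_simps)
  next
    case 2
    then show ?thesis
      by (simp only: br2 alt_def brx) (simp add: algebra_simps)
  next
    case 3
    have "br (br u v) w k + br (br v w) u k + br (br w u) v k =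
      br (br u v) w 3 + br (br v w) u 3 + br (br w u) v 3" using 3 by simp
    moreover have "(3::nat) - 1 = 2" by simp
    moreover have "3 \<in> {3..2*n-1}" using 3 by simp
    ultimately show ?thesis
      by (simp only: br3 br2 br1 alt_def brx) (simp add: algebra_simps)
  next
    case 4
    then have *: "k \<in> {3..2*n-1}" "k - 1 \<in> {3..2*n-1}" by auto
    have "of_nat (k - 1) = (of_nat k - 1 :: complex)" using 4 by (simp add: of_nat_diff)
    then show ?thesis
      by (simp only: br3[OF *(1)] br3[OF *(2)] br1 alt_def brx) (simp add: algebra_simps)
  next
    case 5
    have "ww v u = ww u v + omega v u" "ww w v = ww v w + omega w v" "ww w u = ww u w + omega w u"
      "omega v u = - omega u v" "omega w v = - omega v w" "omega w u = - omega u w"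
      by (rule ww_diff omega_swap)+
    moreover have "tt v u = tt u v" "tt w v = tt v w" "tt w u = tt u w"
      by (rule tt_commute)+
    ultimately show ?thesis using 5
      by (simp only: br2n br1 brx omega_br alt_def) (simp add: algebra_simps)
  next
    case 6
    then show ?thesis using n by (auto simp: br_def)
  qed
qed

private lemma omega_add: "omega (\<lambda>i. u i + v i) w = omega u w + omega v w"
  by (simp add: omega_def sum.distrib[symmetric] algebra_simps)

private lemma omega_smul: "omega (\<lambda>i. c * u i) w = c * omega u w"
  unfolding omega_def sum_distrib_left by (rule sum.cong) (auto simp: algebra_simps)

private lemma br_add: "br (\<lambda>i. u i + v i) w k = br u w k + br v w k"
  unfolding br_def omega_add alt_def by (auto simp: algebra_simps)

private lemma br_smul: "br (\<lambda>i. c * u i) w k = c * br u w k"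
  unfolding br_def omega_smul alt_def by (auto simp: algebra_simps)

private lemma br_swap: "br u v k = - br v u k"
  by (simp add: br_def alt_def omega_swap[of u v] algebra_simps)

private definition unit :: "nat \<Rightarrow> nat \<Rightarrow> complex" where
  "unit i k = (if k = i then 1 else 0)"

private lemma omega_unit:
  "omega (unit i) (unit j) = (if i \<in> {2..2*n-1} \<and> i + j = 2*n+1 then (-1) ^ i else 0)"
proof -
  have "omega (unit i) (unit j) =
      (\<Sum>k = 2..2*n-1. if k = i then (if i + j = 2*n+1 then (-1) ^ i else 0) else 0)"
    unfolding omega_def by (rule sum.cong) (auto simp: unit_def)
  then show ?thesis by simp
qed

private lemma alt_unit:
  "alt (unit i) (unit j) a b =
    (if a = i \<and> b = j then 1 else 0) - (if b = i \<and> a = j then 1 else 0)"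
proof -
  have "(if P then 1 else 0) * (if Q then 1 else 0) = (if P \<and> Q then 1 else (0 :: complex))" for P Q
    by simp
  then show ?thesis by (simp only: alt_def unit_def)
qed

private lemma br_eqI:
  assumes "f 1 = alt u v 1 (2*n+1)"
    and "f 2 = (2 - of_nat n) * alt u v 2 (2*n+1)"
    and "\<And>k. 3 \<le> k \<Longrightarrow> k < 2*n \<Longrightarrow>
      f k = alt u v (k-1) 1 + (of_nat k - of_nat n) * alt u v k (2*n+1)"
    and "f (2*n) = omega u v + \<epsilon> * alt u v 1 (2*n+1) + alt u v (2*n) (2*n+1)"
    and "\<And>k. k = 0 \<or> k > 2*n \<Longrightarrow> f k = 0"
  shows "br u v = f"
proof
  fix k
  consider "k = 1" | "k = 2" | "3 \<le> k" "k < 2*n" | "k = 2*n" | "k = 0 \<or> k > 2*n" by linarith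
  then show "br u v k = f k"
  proof cases
    case 1
    then show ?thesis using assms(1) by (simp add: br_def)
  next
    case 2
    then have "k \<noteq> 1" "k \<in> {2..2*n-1}" using n by auto
    then show ?thesis using assms(2) 2 by (simp only: br_def if_True if_False) simp
  next
    case 3
    then have "k \<noteq> 1" "k \<in> {2..2*n-1}" "k \<noteq> 2" by auto
    then show ?thesis using assms(3)[OF 3] by (simp only: br_def if_True if_False)
  next
    case 4
    then have "k \<noteq> 1" "k \<notin> {2..2*n-1}" using n by auto
    then show ?thesis using assms(4) 4 by (simp only: br_def if_True if_False refl)
  next
    case 5
    then have "k \<noteq> 1" "k \<notin> {2..2*n-1}" "k \<noteq> 2*n" using n by auto
    then show ?thesis using assms(5)[OF 5] by (simp only: br_def if_False)
  qed
qed

private lemma alt_e_e: "i \<le> 2*n \<Longrightarrow> j \<le> 2*n \<Longrightarrow> alt (unit i) (unit j) a (2*n+1) = 0"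
  by (simp add: alt_def unit_def)

private lemma alt_e_x: "i \<le> 2*n \<Longrightarrow> alt (unit i) (unit (2*n+1)) a (2*n+1) = unit i a"
  by (simp add: alt_def unit_def)

private lemma alt_e_x_1: "a \<le> 2*n \<Longrightarrow> n > 0 \<Longrightarrow> alt (unit i) (unit (2*n+1)) a 1 = 0"
  by (simp add: alt_def unit_def)

private lemma alt_e_e1: "i \<noteq> 1 \<Longrightarrow> alt (unit i) (unit 1) a 1 = unit i a"
  by (simp add: alt_def unit_def)

private lemma alt_e_e_1: "i \<noteq> 1 \<Longrightarrow> j \<noteq> 1 \<Longrightarrow> alt (unit i) (unit j) a 1 = 0"
  by (simp add: alt_def unit_def)

private lemma omega_unit_0: "i + j \<noteq> 2*n+1 \<or> i = 1 \<Longrightarrow> omega (unit i) (unit j) = 0"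
  unfolding omega_unit by (subst if_not_P) auto

private lemma br_unit_e1:
  assumes "i \<in> {2..2*n-2}"
  shows "br (unit i) (unit 1) = unit (i + 1)"
proof -
  have i: "2 \<le> i" "i \<noteq> 1" "i \<le> 2*n" "1 \<le> 2*n" "i + 1 \<noteq> 2*n+1" "i + 1 < 2*n" using assms n by auto
  have [simp]: "alt (unit i) (unit (Suc 0)) a (Suc (2*n)) = 0"
    "alt (unit i) (unit (Suc 0)) a (Suc 0) = unit i a" "omega (unit i) (unit (Suc 0)) = 0" for a
    using alt_e_e[OF i(3,4)] alt_e_e1[OF i(2)] omega_unit_0[of i 1] i(5) by simp_all
  show ?thesis
  proof (rule br_eqI)
    fix k :: nat assume "3 \<le> k" "k < 2*n"
    have "unit (i + 1) k = unit i (k - 1)" using \<open>3 \<le> k\<close> by (auto simp: unit_def)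
    then show "unit (i + 1) k = alt (unit i) (unit 1) (k-1) 1
        + (of_nat k - of_nat n) * alt (unit i) (unit 1) k (2*n+1)" by simp
  qed (use i in \<open>auto simp: unit_def\<close>)
qed

private lemma br_unit_e:
  assumes "i \<in> {2..n}"
  shows "br (unit i) (unit (2*n+1-i)) = (\<lambda>k. (-1) ^ i * unit (2*n) k)"
proof -
  define j where "j = 2*n+1-i"
  have i: "i \<noteq> 1" "j \<noteq> 1" "i \<le> 2*n" "j \<le> 2*n" "i + j = 2*n+1" "i \<in> {2..2*n-1}"
    using assms n by (auto simp: j_def)
  have [simp]: "alt (unit i) (unit j) a (Suc (2*n)) = 0" "alt (unit i) (unit j) a (Suc 0) = 0" for a
    using alt_e_e[OF i(3,4)] alt_e_e_1[OF i(1,2)] by simp_all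
  have [simp]: "omega (unit i) (unit j) = (-1) ^ i"
    unfolding omega_unit using i by (subst if_P) auto
  show ?thesis unfolding j_def[symmetric]
    by (rule br_eqI) (use n in \<open>auto simp: unit_def\<close>)
qed

private lemma br_unit_x:
  assumes "i \<in> {1..2*n}"
    and "f 1 = unit i 1"
    and "f 2 = (2 - of_nat n) * unit i 2"
    and "\<And>k. 3 \<le> k \<Longrightarrow> k < 2*n \<Longrightarrow> f k = (of_nat k - of_nat n) * unit i k"
    and "f (2*n) = \<epsilon> * unit i 1 + unit i (2*n)"
    and "\<And>k. k = 0 \<or> k > 2*n \<Longrightarrow> f k = 0"
  shows "br (unit i) (unit (2*n+1)) = f"
proof -
  have i: "i \<le> 2*n" "i + (2*n+1) \<noteq> 2*n+1" using assms(1) by auto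
  have 1: "alt (unit i) (unit (2*n+1)) (k-1) 1 = 0" if "k < 2*n" for k
    using that by (intro alt_e_x_1) auto
  show ?thesis
    by (rule br_eqI, unfold alt_e_x[OF i(1)])
      (simp_all only: assms omega_unit_0[OF disjI1[OF i(2)]] 1 add_0_left)
qed

private lemma br_unit_e1_x: "br (unit 1) (unit (2*n+1)) = (\<lambda>k. unit 1 k + \<epsilon> * unit (2*n) k)"
proof -
  have "1 \<le> n" "2*n \<noteq> 1" "2*n \<noteq> 2" using n by auto
  then show ?thesis by (intro br_unit_x) (auto simp: unit_def)
qed

private lemma br_unit_e_x:
  assumes "i \<in> {2..2*n-1}"
  shows "br (unit i) (unit (2*n+1)) = (\<lambda>k. (of_nat i - of_nat n) * unit i k)"
proof -
  have "2 \<le> i" "i < 2*n" using assms n by auto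
  then show ?thesis by (intro br_unit_x) (auto simp: unit_def)
qed

private lemma br_unit_e2n_x: "br (unit (2*n)) (unit (2*n+1)) = unit (2*n)"
proof -
  have "1 \<le> n" "2*n \<noteq> 1" "2*n \<noteq> 2" using n by auto
  then show ?thesis by (intro br_unit_x) (auto simp: unit_def)
qed

private lemma br_unit_zero:
  assumes ij: "i \<in> {1..2*n}" "j \<in> {1..2*n}"
    and np: "(i, j) \<notin> prescribed_pairs n" "(j, i) \<notin> prescribed_pairs n"
  shows "br (unit i) (unit j) = (\<lambda>k. 0)"
proof -
  have 1: "\<not> (j = 1 \<and> i \<in> {2..2*n-2})"
    using np(1) unfolding prescribed_pairs_def by blast
  have 6: "\<not> (i = 1 \<and> j \<in> {2..2*n-2})"
    using np(2) unfolding prescribed_pairs_def by blast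
  have 2: "\<not> (i \<in> {2..n} \<and> i + j = 2*n+1)"
  proof
    assume "i \<in> {2..n} \<and> i + j = 2*n+1"
    then have "i \<in> {2..n}" "j = 2*n+1-i" by auto
    then show False using np(1) unfolding prescribed_pairs_def by blast
  qed
  have 3: "\<not> (j \<in> {2..n} \<and> i + j = 2*n+1)"
  proof
    assume "j \<in> {2..n} \<and> i + j = 2*n+1"
    then have "j \<in> {2..n}" "i = 2*n+1-j" by auto
    then show False using np(2) unfolding prescribed_pairs_def by blast
  qed
  have "\<not> (i \<in> {2..2*n-1} \<and> i + j = 2*n+1)"
  proof
    assume "i \<in> {2..2*n-1} \<and> i + j = 2*n+1"
    then have "i \<in> {2..n} \<or> j \<in> {2..n}" "i + j = 2*n+1" by auto
    with 2 3 show False by blast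
  qed
  then have 3: "omega (unit i) (unit j) = 0"
    unfolding omega_unit by simp
  have 4: "alt (unit i) (unit j) l (2*n+1) = 0" for l
    using ij by (auto simp: alt_def unit_def)
  have 5: "alt (unit i) (unit j) (l-1) 1 = 0" if "3 \<le> l" "l < 2*n" for l
  proof -
    have "\<not> (l - 1 = i \<and> 1 = j)" "\<not> (1 = i \<and> l - 1 = j)" using 1 6 that by auto
    then show ?thesis by (simp only: alt_unit if_False diff_self)
  qed
  show ?thesis
    by (rule br_eqI) (simp_all only: 3 4 5, simp_all)
qed

lemma r_algebra_exists:
  assumes card: "CARD('m::finite) = 2*n+1"
  shows "\<exists>bracket e x. r_algebra ((*s) :: complex \<Rightarrow> complex ^ 'm \<Rightarrow> complex ^ 'm) bracket n \<epsilon> e x"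
proof -
  have "\<exists>g. bij_betw g {1..2*n+1} (UNIV :: 'm set)"
    using card by (intro finite_same_card_bij) auto
  then obtain g where g: "bij_betw g {1..2*n+1} (UNIV :: 'm set)" by blast
  define h where "h = inv_into {1..2*n+1} g"
  have gh: "g (h m) = m" and h_in: "h m \<in> {1..2*n+1}" for m
    using g unfolding h_def bij_betw_def by (metis UNIV_I f_inv_into_f inv_into_into)+
  have hg: "h (g i) = i" if "i \<in> {1..2*n+1}" for i
    using g that unfolding h_def bij_betw_def by simp
  define co :: "complex ^ 'm \<Rightarrow> nat \<Rightarrow> complex"
    where "co v i = (if i \<in> {1..2*n+1} then v $ g i else 0)" for v i
  define bracket :: "complex ^ 'm \<Rightarrow> complex ^ 'm \<Rightarrow> complex ^ 'm"
    where "bracket u v = (\<chi> m. br (co u) (co v) (h m))" for u v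
  define e :: "nat \<Rightarrow> complex ^ 'm" where "e i = axis (g i) 1" for i
  have co_bracket: "co (bracket u v) = br (co u) (co v)" for u v
    using n by (auto simp: co_def bracket_def hg fun_eq_iff br_def)
  have co_add: "co (u + v) = (\<lambda>i. co u i + co v i)" for u v
    by (auto simp: co_def fun_eq_iff)
  have co_smul: "co (c *s u) = (\<lambda>i. c * co u i)" for c u
    by (auto simp: co_def fun_eq_iff)
  have co_e: "co (e i) = unit i" if "i \<in> {1..2*n+1}" for i
  proof
    fix k
    have "k \<in> {1..2*n+1} \<Longrightarrow> g k = g i \<longleftrightarrow> k = i" using that hg by metis
    then show "co (e i) k = unit i k" using that by (auto simp: co_def e_def axis_def unit_def)
  qed
  have co_inject: "u = v" if "co u = co v" for u v
  proof -
    have "u $ m = v $ m" for m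
      using fun_cong[OF that, of "h m"] h_in[of m] by (simp add: co_def gh)
    then show ?thesis by (simp add: vec_eq_iff)
  qed
  have swap: "bracket u v = - bracket v u" for u v
    by (simp add: vec_eq_iff bracket_def br_swap[of "co u" "co v"])
  have add: "bracket (u + v) w = bracket u w + bracket v w" for u v w
    by (rule co_inject) (simp add: co_bracket co_add br_add fun_eq_iff)
  have smul: "bracket (c *s u) w = c *s bracket u w" for c u w
    by (rule co_inject) (simp add: co_bracket co_smul br_smul fun_eq_iff)
  have basis: "insert (e (2*n+1)) (e ` {1..2*n}) = cart_basis"
  proof -
    have "insert (e (2*n+1)) (e ` {1..2*n}) = e ` {1..2*n+1}"
      by (simp add: atLeastAtMostSuc_conv)
    also have "\<dots> = (\<lambda>m. axis m 1) ` (g ` {1..2*n+1})"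
      by (simp add: e_def image_image)
    also have "\<dots> = cart_basis"
      using g by (auto simp: bij_betw_def cart_basis_def)
    finally show ?thesis .
  qed
  have inj: "inj_on e {1..2*n+1}"
    using g by (auto simp: inj_on_def e_def axis_eq_axis bij_betw_def)
  have "r_algebra (*s) bracket n \<epsilon> e (e (2*n+1))"
  proof
    fix u v w :: "complex ^ 'm" and c :: complex
    show "bracket (u + v) w = bracket u w + bracket v w" by (rule add)
    show "bracket (c *s u) w = c *s bracket u w" by (rule smul)
    show "bracket u (v + w) = bracket u v + bracket u w"
      unfolding swap[of u "v + w"] swap[of u v] swap[of u w] add by simp
    show "bracket u (c *s v) = c *s bracket u v"
      unfolding swap[of u "c *s v"] swap[of u v] smul by (simp add: vec_eq_iff)
    show "bracket u u = 0"
      using swap[of u u] by (simp add: vec_eq_iff)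
    show "bracket (bracket u v) w + bracket (bracket v w) u + bracket (bracket w u) v = 0"
      by (rule co_inject) (simp add: co_add co_bracket br_jacobi, simp add: co_def fun_eq_iff)
    show "inj_on e {1..2*n}" using inj by (rule inj_on_subset) auto
    show "e (2*n+1) \<notin> e ` {1..2*n}"
    proof
      assume "e (2*n+1) \<in> e ` {1..2*n}"
      then obtain i where i: "i \<in> {1..2*n}" "e (2*n+1) = e i" by blast
      then have "2*n+1 = i" using inj by (intro inj_onD[OF inj i(2)]) auto
      then show False using i(1) by simp
    qed
    show "vec.independent (insert (e (2*n+1)) (e ` {1..2*n}))"
      unfolding basis by (rule independent_cart_basis)
    show "vec.span (insert (e (2*n+1)) (e ` {1..2*n})) = UNIV"
      unfolding basis by (rule span_cart_basis)
  next
    fix i assume i: "i \<in> {2..2*n-2}"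
    then have *: "i \<in> {1..2*n+1}" "1 \<in> {1..2*n+1}" "i + 1 \<in> {1..2*n+1}" by auto
    show "bracket (e i) (e 1) = e (i + 1)"
      using * by (intro co_inject) (simp only: co_bracket co_e br_unit_e1[OF i])
  next
    fix i assume i: "i \<in> {2..n}"
    then have "i \<in> {1..2*n+1}" "2*n+1-i \<in> {1..2*n+1}" "2*n \<in> {1..2*n+1}" by auto
    then show "bracket (e i) (e (2*n+1-i)) = (-1) ^ i *s e (2*n)"
      by (intro co_inject) (simp only: co_bracket co_e co_smul br_unit_e[OF i])
  next
    have "1 \<in> {1..2*n+1}" "2*n+1 \<in> {1..2*n+1}" "2*n \<in> {1..2*n+1}" using n by auto
    then show "bracket (e 1) (e (2*n+1)) = e 1 + \<epsilon> *s e (2*n)"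
      by (intro co_inject)
        (simp only: co_bracket co_e co_add co_smul br_unit_e1_x)
  next
    fix i assume i: "i \<in> {2..2*n-1}"
    then have "i \<in> {1..2*n+1}" "2*n+1 \<in> {1..2*n+1}" by auto
    then show "bracket (e i) (e (2*n+1)) = (of_nat i - of_nat n) *s e i"
      by (intro co_inject) (simp only: co_bracket co_e co_smul br_unit_e_x[OF i])
  next
    have "2*n+1 \<in> {1..2*n+1}" "2*n \<in> {1..2*n+1}" using n by auto
    then show "bracket (e (2*n)) (e (2*n+1)) = e (2*n)"
      by (intro co_inject) (simp only: co_bracket co_e br_unit_e2n_x)
  next
    fix i j
    assume ij: "i \<in> {1..2*n}" "j \<in> {1..2*n}"
      and np: "(i, j) \<notin> prescribed_pairs n" "(j, i) \<notin> prescribed_pairs n"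
    have *: "i \<in> {1..2*n+1}" "j \<in> {1..2*n+1}" using ij by auto
    have "co 0 = (\<lambda>k. 0)" by (simp add: co_def fun_eq_iff)
    then show "bracket (e i) (e j) = 0"
      using * by (intro co_inject) (simp only: co_bracket co_e br_unit_zero[OF ij np])
  qed
  then show ?thesis by blast
qed

end

end

theory Submission
  imports Defs
begin

text \<open>
  Subtracting \<open>a\<close> times the identity, which is itself a half-derivation, we may assume that the
  \<open>x\<close>-coordinate of \<open>\<phi> x\<close> vanishes. Then \<open>\<phi>\<close> maps the nilradical into itself. Because of the factor
  \<open>1/2\<close>, the brackets with \<open>x\<close> force \<open>(2 * \<lambda>\<^sub>j - \<lambda>\<^sub>k)\<close> times the \<open>e k\<close>-coordinate of \<open>\<phi> (e j)\<close>, where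
  \<open>\<lambda>\<close> are the weights of \<open>ad x\<close>, to be a coordinate of \<open>\<phi> x\<close> or zero. For the generators \<open>e 1\<close> and
  \<open>e 2\<close> of the nilradical almost no resonance \<open>\<lambda>\<^sub>k = 2 * \<lambda>\<^sub>j\<close> occurs. Propagating along
  \<open>e (j + 1) = [e j, e 1]\<close> and comparing with these relations for \<open>e (j + 1)\<close> eliminates all
  remaining coordinates but two.
\<close>

declare One_nat_def [simp del]

section \<open>Coordinates in the given basis, and bilinearity of the bracket\<close>

context r_algebra
begin

text \<open>Serves to check formulas linear in one argument, such as the bracket formulas below, on
  basis vectors only.\<close>

lemma basis_induct [case_names zero add scale e x]:
  assumes "P 0"
    and "\<And>u v. P u \<Longrightarrow> P v \<Longrightarrow> P (u + v)"
    and "\<And>c u. P u \<Longrightarrow> P (c *\<^sub>C u)"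
    and "\<And>i. i \<in> {1..2*n} \<Longrightarrow> P (e i)"
    and "P x"
  shows "P u"
proof -
  have "u \<in> span (insert x (e ` {1..2*n}))" by (simp only: span_basis UNIV_I)
  then show ?thesis
  proof (induction rule: span_induct_alt)
    case base
    show ?case by (rule assms(1))
  next
    case (step c v w)
    then show ?case using assms(2-5) by blast
  qed
qed

text \<open>Index \<open>0\<close> stands for the basis vector \<open>x\<close>; indices above \<open>2 * n\<close> give junk values.\<close>

definition coord :: "nat \<Rightarrow> 'a \<Rightarrow> complex" where
  "coord k u = representation (insert x (e ` {1..2*n})) u (if k = 0 then x else e k)"

lemma coord_add [simp]: "coord k (u + v) = coord k u + coord k v"
  by (simp add: coord_def representation_add[OF independent_basis] span_basis)

lemma coord_scale [simp]: "coord k (c *\<^sub>C u) = c * coord k u"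
  by (simp add: coord_def representation_scale[OF independent_basis] span_basis)

lemma coord_zero [simp]: "coord k 0 = 0"
  using coord_add[of k 0 0] by simp

lemma coord_minus [simp]: "coord k (- u) = - coord k u"
  using coord_add[of k u "- u"] by (simp add: eq_neg_iff_add_eq_0 add.commute)

lemma coord_diff [simp]: "coord k (u - v) = coord k u - coord k v"
  using coord_add[of k u "- v"] by simp

lemma coord_e:
  assumes "i \<in> {1..2*n}" "k \<le> 2*n"
  shows "coord k (e i) = (if k = i then 1 else 0)"
proof -
  have "e i \<noteq> x" "k \<noteq> 0 \<Longrightarrow> e k = e i \<longleftrightarrow> k = i"
    using assms x_notin inj_e by (auto simp: inj_on_eq_iff)
  moreover have "representation (insert x (e ` {1..2*n})) (e i) = (\<lambda>v. if v = e i then 1 else 0)"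
    using assms by (intro representation_basis[OF independent_basis]) auto
  ultimately show ?thesis using assms by (auto simp: coord_def)
qed

lemma coord_x:
  assumes "k \<le> 2*n"
  shows "coord k x = (if k = 0 then 1 else 0)"
proof -
  have "k \<noteq> 0 \<Longrightarrow> e k \<noteq> x" using assms x_notin by auto
  moreover have "representation (insert x (e ` {1..2*n})) x = (\<lambda>v. if v = x then 1 else 0)"
    by (intro representation_basis[OF independent_basis]) auto
  ultimately show ?thesis by (auto simp: coord_def)
qed

lemma coord_eqI:
  assumes "\<And>k. k \<le> 2*n \<Longrightarrow> coord k u = coord k v"
  shows "u = v"
proof -
  let ?B = "insert x (e ` {1..2*n})"
  have "representation ?B u w = representation ?B v w" if "w \<in> ?B" for w
  proof (cases "w = x")
    case True
    then show ?thesis using assms[of 0] by (simp add: coord_def)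
  next
    case False
    then obtain i where "i \<in> {1..2*n}" "w = e i" using \<open>w \<in> ?B\<close> by auto
    then show ?thesis using assms[of i] by (simp add: coord_def)
  qed
  then have "(\<Sum>w\<in>?B. representation ?B u w *\<^sub>C w) = (\<Sum>w\<in>?B. representation ?B v w *\<^sub>C w)"
    by (intro sum.cong) auto
  moreover have "(\<Sum>w\<in>?B. representation ?B y w *\<^sub>C w) = y" for y
    using span_basis by (intro sum_representation_eq independent_basis) auto
  ultimately show ?thesis by simp
qed

lemma bracket_add_left: "bracket (u + v) w = bracket u w + bracket v w"
  and bracket_scale_left: "bracket (c *\<^sub>C u) w = c *\<^sub>C bracket u w"
  using linear_left[of w] by (simp_all add: Vector_Spaces.linear_iff)

lemma bracket_add_right: "bracket u (v + w) = bracket u v + bracket u w"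
  and bracket_scale_right: "bracket u (c *\<^sub>C v) = c *\<^sub>C bracket u v"
  using linear_right[of u] by (simp_all add: Vector_Spaces.linear_iff)

lemma bracket_zero_left [simp]: "bracket 0 u = 0"
  using bracket_add_left[of 0 0 u] by simp

lemma bracket_zero_right [simp]: "bracket u 0 = 0"
  using bracket_add_right[of u 0 0] by simp

lemma bracket_swap: "bracket u v = - bracket v u"
  using bracket_self[of "u + v"] unfolding bracket_add_left bracket_add_right
  by (simp add: bracket_self eq_neg_iff_add_eq_0 add.commute)

end

section \<open>Brackets of basis vectors with arbitrary vectors\<close>

locale r_algebra_ge3 = r_algebra +
  assumes n_ge3: "n \<ge> 3"
begin

text \<open>The presentation prescribes only \<open>i \<le> n\<close>. For larger \<open>i\<close>,
  antisymmetry exchanges \<open>i\<close> and \<open>j\<close>, and its sign is absorbed because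
  \<open>i + j\<close> is odd.\<close>

lemma bracket_e_reflect:
  assumes "i \<in> {2..2*n-1}" "i + j = 2*n+1"
  shows "bracket (e i) (e j) = (-1) ^ i *\<^sub>C e (2*n)"
proof (cases "i \<le> n")
  case True
  have "j = 2*n+1-i" using assms by simp
  then show ?thesis using bracket_e_e[of i] True assms by simp
next
  case False
  then have j: "j \<in> {2..n}" "i = 2*n+1-j" using assms by auto
  have "even i \<longleftrightarrow> odd j" using assms(2) by presburger
  then have "(-1) ^ i = - ((-1) ^ j :: complex)" by (simp add: minus_one_power_iff)
  then show ?thesis using bracket_e_e[OF j(1)] bracket_swap[of "e i" "e j"] j(2)
    by (simp add: scale_minus_left)
qed

lemma bracket_e_zero:
  assumes "i \<in> {2..2*n}" "j \<in> {2..2*n}" "i + j \<noteq> 2*n+1"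
  shows "bracket (e i) (e j) = 0"
  using assms by (intro bracket_zero) (auto simp: prescribed_pairs_def)

lemma bracket_e1_top:
  assumes "i \<in> {2*n-1, 2*n}"
  shows "bracket (e i) (e 1) = 0"
  using assms n_ge3 by (intro bracket_zero) (auto simp: prescribed_pairs_def)

text \<open>Needed for unknown \<open>v\<close> such as \<open>\<psi> x\<close> or
  \<open>\<psi> (e 1)\<close>: only three coordinates of \<open>v\<close> matter. The inner
  \<open>if\<close> is there because \<open>e (2*n-1)\<close> commutes with \<open>e 1\<close>,
  whereas the index pattern would suggest \<open>e (2*n)\<close>.\<close>

lemma bracket_e_left:
  assumes "j \<in> {2..2*n-1}"
  shows "bracket (e j) v = coord 1 v *\<^sub>C (if j = 2*n-1 then 0 else e (j+1))
    + ((-1)^j * coord (2*n+1-j) v) *\<^sub>C e (2*n) + ((of_nat j - of_nat n) * coord 0 v) *\<^sub>C e j"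
proof (induction v rule: basis_induct)
  case (add u v)
  then show ?case by (simp add: bracket_add_right scale_left_distrib distrib_left add_ac)
next
  case (scale c u)
  then show ?case by (simp add: bracket_scale_right scale_right_distrib mult.left_commute)
next
  case (e i)
  show ?case
  proof (cases "i = 1")
    case True
    then show ?thesis
      using assms e n_ge3 bracket_e_e1[of j] bracket_e1_top[of j]
      by (cases "j = 2*n-1") (auto simp: coord_e)
  next
    case False
    then have i: "i \<in> {2..2*n}" using e by auto
    show ?thesis
    proof (cases "j + i = 2*n+1")
      case True
      then have "2*n+1-j = i" by simp
      then show ?thesis using True assms i bracket_e_reflect[of j i] by (auto simp: coord_e)
    next
      case False
      then have "coord (2*n+1-j) (e i) = 0" using assms e by (subst coord_e) auto
      moreover have "bracket (e j) (e i) = 0" using False assms i by (intro bracket_e_zero) auto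
      ultimately show ?thesis using i by (simp add: coord_e)
    qed
  qed
next
  case x
  show ?case using assms bracket_e_x[of j] by (auto simp: coord_x)
qed simp_all

lemma bracket_e2n_left: "bracket (e (2*n)) v = coord 0 v *\<^sub>C e (2*n)"
proof (induction v rule: basis_induct)
  case (e i)
  have "bracket (e (2*n)) (e i) = 0"
    using e bracket_e1_top[of "2*n"] bracket_e_zero[of "2*n" i] by (cases "i = 1") auto
  then show ?case using e by (simp add: coord_e)
qed (simp_all add: bracket_add_right bracket_scale_right scale_left_distrib coord_x bracket_e2n_x)

text \<open>The sign is reversed because the presentation prescribes \<open>[e i, e 1]\<close>.
  Index 2 is missed because no \<open>[e i, e 1]\<close> reaches \<open>e 2\<close>.\<close>

lemma coord_bracket_e1_left:
  assumes "k \<le> 2*n"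
  shows "coord k (bracket (e 1) v) =
    (if k = 1 then coord 0 v else if k \<in> {3..2*n-1} then - coord (k-1) v
     else if k = 2*n then \<epsilon> * coord 0 v else 0)"
proof (induction v rule: basis_induct)
  case (e i)
  consider "i = 1" | "i \<in> {2..2*n-2}" | "i \<in> {2*n-1,2*n}" using e by force
  then show ?case
  proof cases
    case 1
    then show ?thesis using assms n_ge3 by (auto simp: bracket_self coord_e)
  next
    case 2
    then have "bracket (e 1) (e i) = - e (i+1)" using bracket_e_e1 bracket_swap by metis
    then show ?thesis using assms 2 by (auto simp: coord_e)
  next
    case 3
    then have "bracket (e 1) (e i) = 0" using bracket_e1_top bracket_swap[of "e 1" "e i"] by simp
    then show ?thesis using assms 3 n_ge3 by (auto simp: coord_e)
  qed
next
  case x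
  show ?case using assms n_ge3 by (auto simp: bracket_e1_x coord_x coord_e)
qed (auto simp: bracket_add_right bracket_scale_right algebra_simps)

lemma coord_bracket_x:
  assumes "k \<le> 2*n"
  shows "coord k (bracket u x) =
    (if k = 0 then 0 else if k = 1 then coord 1 u else if k = 2*n then coord (2*n) u + \<epsilon> * coord 1 u
     else (of_nat k - of_nat n) * coord k u)"
proof (induction u rule: basis_induct)
  case (e i)
  consider "i = 1" | "i \<in> {2..2*n-1}" | "i = 2*n" using e by force
  then show ?case
  proof cases
    case 1
    then show ?thesis using assms n_ge3 by (auto simp: bracket_e1_x coord_e)
  next
    case 2
    then show ?thesis using assms by (auto simp: bracket_e_x coord_e)
  next
    case 3
    then show ?thesis using assms n_ge3 by (auto simp: bracket_e2n_x coord_e)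
  qed
next
  case x
  show ?case using assms by (auto simp: bracket_self coord_x)
qed (auto simp: bracket_add_left bracket_scale_left algebra_simps)

text \<open>All brackets of basis vectors lie in the span of the \<open>e i\<close>. This is what
  later forces \<open>\<psi>\<close> to send each \<open>e i\<close> into that span.\<close>

lemma coord_0_bracket: "coord 0 (bracket u v) = 0"
proof (induction u rule: basis_induct)
  case (e i)
  show ?case
  proof (induction v rule: basis_induct)
    case (e j)
    consider "i = 1" | "j = 1" | "i \<in> {2..2*n}" "j \<in> {2..2*n}"
      using e \<open>i \<in> {1..2*n}\<close> by force
    then show ?case
    proof cases
      case 1
      then show ?thesis using coord_bracket_e1_left[of 0] n_ge3 by simp
    next
      case 2
      then show ?thesis using coord_bracket_e1_left[of 0 "e i"] n_ge3 bracket_swap[of "e i" "e j"] by simp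
    next
      case 3
      then show ?thesis using bracket_e_zero[of i j] bracket_e_reflect[of i j]
        by (cases "i + j = 2*n+1") (auto simp: coord_e)
    qed
  qed (simp_all add: bracket_add_right bracket_scale_right coord_bracket_x)
next
  case x
  show ?case using coord_bracket_x[of 0 v] bracket_swap[of x v] by simp
qed (simp_all add: bracket_add_left bracket_scale_left)

end

section \<open>Normalized half-derivations: the nilradical and the image of
  \<open>e (2*n)\<close>\<close>

locale normalized_half_derivation = r_algebra_ge3 +
  fixes \<psi> :: "'a \<Rightarrow> 'a"
  assumes half_derivation: "half_derivation smul bracket \<psi>"
    and coord_0_psi_x: "coord 0 (\<psi> x) = 0"
begin

lemma psi_add: "\<psi> (u + v) = \<psi> u + \<psi> v"
  and psi_scale: "\<psi> (c *\<^sub>C u) = c *\<^sub>C \<psi> u"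
  using half_derivation by (simp_all add: half_derivation_def Vector_Spaces.linear_iff)

lemma psi_zero: "\<psi> 0 = 0"
  using psi_add[of 0 0] by simp

lemma psi_bracket: "\<psi> (bracket u v) = (1/2) *\<^sub>C (bracket (\<psi> u) v + bracket u (\<psi> v))"
  using half_derivation by (simp add: half_derivation_def)

lemma coord_psi_bracket:
  "2 * coord k (\<psi> (bracket u v)) = coord k (bracket (\<psi> u) v) + coord k (bracket u (\<psi> v))"
  by (simp add: psi_bracket)

lemma coord_0_psi_bracket: "coord 0 (\<psi> (bracket u v)) = 0"
  by (simp add: psi_bracket coord_0_bracket)

text \<open>Each \<open>e i\<close> is recovered from brackets, whose images have no
  \<open>x\<close>-coordinate. From index 3 on \<open>[e (i-1), e 1]\<close> is used, because the
  weight \<open>i - n\<close> of \<open>[e i, x]\<close> vanishes at \<open>i = n\<close>. For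
  \<open>e 2\<close> the weight \<open>2 - n\<close> is nonzero since
  \<open>n \<ge> 3\<close>.\<close>

lemma coord_0_psi_e:
  assumes "i \<in> {1..2*n}"
  shows "coord 0 (\<psi> (e i)) = 0"
proof -
  have top: "coord 0 (\<psi> (e (2*n))) = 0"
    using coord_0_psi_bracket[of "e (2*n)" x] by (simp add: bracket_e2n_x)
  consider "i = 1" | "i = 2" | "i \<in> {3..2*n-1}" | "i = 2*n" using assms by force
  then show ?thesis
  proof cases
    case 1
    then show ?thesis
      using coord_0_psi_bracket[of "e 1" x] top by (simp add: bracket_e1_x psi_add psi_scale)
  next
    case 2
    have "2 - of_nat n \<noteq> (0 :: complex)" using n_ge3 by (simp add: complex_eq_iff)
    then show ?thesis
      using coord_0_psi_bracket[of "e 2" x] 2 n_ge3 by (simp add: bracket_e_x psi_scale)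
  next
    case 3
    then have "bracket (e (i-1)) (e 1) = e (i - 1 + 1)" by (intro bracket_e_e1) auto
    then show ?thesis using coord_0_psi_bracket[of "e (i-1)" "e 1"] 3 by simp
  next
    case 4
    then show ?thesis using top by simp
  qed
qed

text \<open>As \<open>e (2*n)\<close> has weight 1, a coordinate of weight \<open>k - n\<close> can
  survive \<open>[e (2*n), x] = e (2*n)\<close> only if \<open>k - n = 2\<close>.\<close>

lemma psi_e_2n: "\<psi> (e (2*n)) = 0"
proof (rule coord_eqI)
  fix k assume k: "k \<le> 2*n"
  have x_eq: "2 * coord k (\<psi> (e (2*n))) = coord k (bracket (\<psi> (e (2*n))) x)" if "k \<le> 2*n" for k
    using coord_psi_bracket[of k "e (2*n)" x, unfolded bracket_e2n_x]
    by (simp add: bracket_e2n_left coord_0_psi_x)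
  have one: "coord 1 (\<psi> (e (2*n))) = 0"
    using x_eq[of 1] n_ge3 by (simp add: coord_bracket_x)
  consider "k = 0" | "k = 1" | "k = n + 2" | "k = 2*n" | "k \<in> {2..2*n-1}" "k \<noteq> n + 2"
    using k by force
  then have "coord k (\<psi> (e (2*n))) = 0"
  proof cases
    case 1
    then show ?thesis using coord_0_psi_e[of "2*n"] n_ge3 by simp
  next
    case 2
    then show ?thesis using one by simp
  next
    \<comment> \<open>The resonant index: \<open>[e (n-1), e (2*n)] = 0\<close>, and
      \<open>e (n-1)\<close> pairs with exactly \<open>e (n+2)\<close> to give a multiple of
      \<open>e (2*n)\<close>.\<close>
    case 3
    have n1: "n - 1 \<in> {2..2*n-1}" "n - 1 \<in> {1..2*n}" "2*n+1-(n-1) = n + 2" using n_ge3 by auto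
    have "bracket (e (n-1)) (e (2*n)) = 0" using n_ge3 by (intro bracket_e_zero) auto
    moreover have "bracket (\<psi> (e (n-1))) (e (2*n)) = 0"
      using bracket_swap[of "\<psi> (e (n-1))" "e (2*n)"] coord_0_psi_e[OF n1(2)]
      by (simp add: bracket_e2n_left)
    ultimately have "coord (2*n) (bracket (e (n-1)) (\<psi> (e (2*n)))) = 0"
      using coord_psi_bracket[of "2*n" "e (n-1)" "e (2*n)"] by (simp add: psi_zero)
    then show ?thesis
      unfolding bracket_e_left[OF n1(1)] n1(3) using 3 n_ge3 one coord_0_psi_e[of "2*n"]
      by (simp add: coord_e)
  next
    case 4
    then show ?thesis using x_eq[of k] one n_ge3 by (simp add: coord_bracket_x)
  next
    case 5
    have "(2 + of_nat n - of_nat k) * coord k (\<psi> (e (2*n))) = 0"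
      using x_eq[of k] 5 n_ge3 by (auto simp: coord_bracket_x algebra_simps)
    moreover have "2 + of_nat n - of_nat k \<noteq> (0 :: complex)"
      using 5(2) by (auto simp: complex_eq_iff)
    ultimately show ?thesis by simp
  qed
  then show "coord k (\<psi> (e (2*n))) = coord k 0" by simp
qed

section \<open>Relations from the brackets \<open>[e j, x]\<close>\<close>

lemma coord_psi_e1:
  assumes "k \<le> 2*n"
  shows "2 * coord k (\<psi> (e 1)) = coord k (bracket (\<psi> (e 1)) x) + coord k (bracket (e 1) (\<psi> x))"
  \<comment> \<open>The \<epsilon>-term of \<open>[e 1, x]\<close> drops out because
    \<open>\<psi> (e (2*n)) = 0\<close>.\<close>
  using coord_psi_bracket[of k "e 1" x] by (simp add: bracket_e1_x psi_add psi_scale psi_e_2n)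

lemma coord_1_psi_e1: "coord 1 (\<psi> (e 1)) = 0"
  using coord_psi_e1[of 1] n_ge3 coord_0_psi_x by (simp add: coord_bracket_x coord_bracket_e1_left)

lemma coord_2_psi_e1: "coord 2 (\<psi> (e 1)) = 0"
proof -
  have "of_nat n * coord 2 (\<psi> (e 1)) = 0"
    using coord_psi_e1[of 2] n_ge3 by (simp add: coord_bracket_x coord_bracket_e1_left algebra_simps)
  then show ?thesis using n_ge3 by simp
qed

lemma coord_2n_psi_e1: "coord (2*n) (\<psi> (e 1)) = 0"
  using coord_psi_e1[of "2*n"] n_ge3 coord_0_psi_x coord_1_psi_e1
  by (simp add: coord_bracket_x coord_bracket_e1_left)

text \<open>At the resonance \<open>k = n + 2\<close> the factor vanishes, so this relation says
  nothing about that coordinate of \<open>\<psi> (e 1)\<close>; \<open>coord_mid_zero\<close>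
  settles it with a second relation.\<close>

lemma coord_psi_e1_mid:
  assumes "k \<in> {3..2*n-1}"
  shows "(2 + of_nat n - of_nat k) * coord k (\<psi> (e 1)) = - coord (k-1) (\<psi> x)"
proof -
  have "k \<le> 2*n" "k \<noteq> 0" "k \<noteq> 1" "k \<noteq> 2*n" using assms by auto
  then show ?thesis using coord_psi_e1[of k] assms
    by (simp add: coord_bracket_x coord_bracket_e1_left algebra_simps)
qed

text \<open>The two conditional terms are \<open>[e j, \<psi> x]\<close>: the \<open>e 1\<close>
  part of \<open>\<psi> x\<close> raises the index, and its reflected part lands in
  \<open>e (2*n)\<close>. The remaining term of \<open>bracket_e_left\<close> vanishes by the
  normalization.\<close>

lemma coord_psi_e:
  assumes "j \<in> {2..2*n-1}" "k \<le> 2*n"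
  shows "2 * ((of_nat j - of_nat n) * coord k (\<psi> (e j))) = coord k (bracket (\<psi> (e j)) x)
    + (if k = j + 1 \<and> k \<noteq> 2*n then coord 1 (\<psi> x) else 0)
    + (if k = 2*n then (-1)^j * coord (2*n+1-j) (\<psi> x) else 0)"
proof -
  have "bracket (e j) x = (of_nat j - of_nat n) *\<^sub>C e j" using assms by (intro bracket_e_x) auto
  then show ?thesis
    using coord_psi_bracket[of k "e j" x] assms coord_0_psi_x
    by (auto simp: psi_scale bracket_e_left coord_e split: if_splits)
qed

section \<open>The image of \<open>e 2\<close> and its trace in \<open>\<psi> x\<close>\<close>

lemma psi_e2_expand: "\<psi> (e 2) = coord 3 (\<psi> (e 2)) *\<^sub>C e 3 + coord (2*n) (\<psi> (e 2)) *\<^sub>C e (2*n)"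
proof (rule coord_eqI)
  fix k assume k: "k \<le> 2*n"
  have two: "2 \<in> {2..2*n-1}" using n_ge3 by auto
  \<comment> \<open>This is \<open>2 * (2 - n) - 1\<close>, the factor at index 1; it is nonzero by
    parity.\<close>
  have ne: "3 - 2 * of_nat n \<noteq> (0 :: complex)"
  proof
    assume "3 - 2 * of_nat n = (0 :: complex)"
    then have "of_nat 3 = (of_nat (2*n) :: complex)" by simp
    then have "3 = 2*n" by (simp only: of_nat_eq_iff)
    then show False by presburger
  qed
  consider "k = 0" | "k = 1" | "k = 3" | "k = 2*n" | "k \<in> {2..2*n-1}" "k \<noteq> 3" using k by force
  then show "coord k (\<psi> (e 2)) =
    coord k (coord 3 (\<psi> (e 2)) *\<^sub>C e 3 + coord (2*n) (\<psi> (e 2)) *\<^sub>C e (2*n))"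
  proof cases
    case 1
    then show ?thesis using coord_0_psi_e[of 2] n_ge3 by (simp add: coord_e)
  next
    case 2
    have "(3 - 2 * of_nat n) * coord 1 (\<psi> (e 2)) = 0"
      using coord_psi_e[OF two, of 1] n_ge3 by (simp add: coord_bracket_x algebra_simps)
    then show ?thesis using 2 ne n_ge3 by (simp add: coord_e)
  next
    \<comment> \<open>The factor is \<open>2 * (2 - n) - (k - n)\<close>, which is negative for
      \<open>n \<ge> 3\<close> and \<open>k \<ge> 2\<close>. Indices 3 and \<open>2*n\<close> are
      set apart because \<open>[e 2, \<psi> x]\<close> contributes there.\<close>
    case 5
    have "(4 - of_nat n - of_nat k) * coord k (\<psi> (e 2)) = 0"
      using coord_psi_e[OF two, of k] 5 n_ge3 by (auto simp: coord_bracket_x algebra_simps)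
    moreover have "4 - of_nat n - of_nat k \<noteq> (0 :: complex)"
    proof
      assume "4 - of_nat n - of_nat k = (0 :: complex)"
      then have "of_nat 4 = (of_nat (n + k) :: complex)" by (simp add: algebra_simps)
      then have "4 = n + k" by (simp only: of_nat_eq_iff)
      then show False using 5 n_ge3 by simp
    qed
    ultimately show ?thesis using 5 k n_ge3 by (auto simp: coord_e)
  qed (use n_ge3 in \<open>auto simp: coord_e\<close>)
qed

text \<open>With \<open>p = coord 1 (\<psi> x)\<close>, the bracket \<open>[e 2, x]\<close> gives
  \<open>(1 - n) * s = p\<close>. Propagation to \<open>e 3 = [e 2, e 1]\<close> halves the
  coordinate, so \<open>[e 3, x]\<close> gives \<open>(2 - n) * s / 2 = p\<close>. Together they
  yield \<open>n * s = 0\<close>. Here \<open>n \<ge> 3\<close> keeps index 4 below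
  \<open>2*n\<close>.\<close>

lemma coord_3_psi_e2: "coord 3 (\<psi> (e 2)) = 0"
proof -
  define s where "s = coord 3 (\<psi> (e 2))"
  have mem: "2 \<in> {2..2*n-1}" "3 \<in> {2..2*n-1}" using n_ge3 by auto
  have p1: "(1 - of_nat n) * s = coord 1 (\<psi> x)"
    using coord_psi_e[OF mem(1), of 3] n_ge3 by (simp add: coord_bracket_x s_def algebra_simps)
  have "bracket (e 2) (e 1) = e 3" "bracket (e 3) (e 1) = e 4"
    using bracket_e_e1[of 2] bracket_e_e1[of 3] n_ge3 by simp_all
  moreover have "coord 4 (bracket (\<psi> (e 2)) (e 1)) = s"
    by (subst psi_e2_expand)
      (use n_ge3 bracket_e1_top[of "2*n"] calculation in
        \<open>simp add: bracket_add_left bracket_scale_left coord_e s_def\<close>)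
  moreover have "coord 4 (bracket (e 2) (\<psi> (e 1))) = 0"
    using n_ge3 coord_0_psi_e[of 1] by (simp add: bracket_e_left[OF mem(1)] coord_e)
  ultimately have "2 * coord 4 (\<psi> (e 3)) = s"
    using coord_psi_bracket[of 4 "e 2" "e 1"] by simp
  moreover have "(2 - of_nat n) * coord 4 (\<psi> (e 3)) = coord 1 (\<psi> x)"
    using coord_psi_e[OF mem(2), of 4] n_ge3 by (simp add: coord_bracket_x algebra_simps)
  ultimately have "(2 - of_nat n) * s = 2 * coord 1 (\<psi> x)" by (simp add: algebra_simps)
  moreover have "of_nat n * s = ((2 - of_nat n) * s - 2 * coord 1 (\<psi> x))
      - 2 * ((1 - of_nat n) * s - coord 1 (\<psi> x))"
    by (simp add: algebra_simps)
  ultimately have "of_nat n * s = 0" using p1 by simp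
  then show ?thesis using n_ge3 by (simp add: s_def)
qed

lemma psi_e2: "\<psi> (e 2) = coord (2*n) (\<psi> (e 2)) *\<^sub>C e (2*n)"
  using psi_e2_expand by (simp add: coord_3_psi_e2)

lemma coord_1_psi_x: "coord 1 (\<psi> x) = 0"
proof -
  have "2 \<in> {2..2*n-1}" using n_ge3 by auto
  then show ?thesis
    using coord_psi_e[of 2 3] n_ge3 coord_3_psi_e2 by (simp add: coord_bracket_x)
qed

text \<open>Origin of the factor in the theorem: at index \<open>2*n\<close> the bracket
  \<open>[e 2, x]\<close> gives \<open>2 * (2 - n) * b = b + coord (2*n-1) (\<psi> x)\<close>, where
  \<open>b\<close> is the \<open>e (2*n)\<close>-coordinate of \<open>\<psi> (e 2)\<close>.\<close>

lemma coord_top_psi_x: "coord (2*n-1) (\<psi> x) = (3 - 2 * of_nat n) * coord (2*n) (\<psi> (e 2))"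
proof -
  have "2 \<in> {2..2*n-1}" "2*n+1-2 = 2*n-1" using n_ge3 by auto
  moreover have "coord 1 (\<psi> (e 2)) = 0" using n_ge3 by (subst psi_e2) (simp add: coord_e)
  ultimately show ?thesis
    using coord_psi_e[of 2 "2*n"] n_ge3 by (simp add: coord_bracket_x algebra_simps)
qed

section \<open>Propagation along \<open>e (j + 1) = [e j, e 1]\<close>\<close>

lemma psi_e_Suc:
  assumes "j \<in> {2..2*n-2}"
  shows "\<psi> (e (j+1)) = ((-1)^j / 2 * coord (2*n+1-j) (\<psi> (e 1))) *\<^sub>C e (2*n)"
proof -
  \<comment> \<open>Since \<open>e (2*n)\<close> commutes with \<open>e 1\<close>, only
    \<open>[e j, \<psi> (e 1)]\<close> remains, again a multiple of \<open>e (2*n)\<close>. The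
    scalar \<open>t\<close> is lost, so one fact serves both the base and the induction
    step.\<close>
  have Suc: "\<psi> (e (j+1)) = ((-1)^j / 2 * coord (2*n+1-j) (\<psi> (e 1))) *\<^sub>C e (2*n)"
    if "j \<in> {2..2*n-2}" "\<psi> (e j) = t *\<^sub>C e (2*n)" for j t
  proof -
    have j: "j \<in> {2..2*n-1}" "j \<noteq> 2*n-1" using that(1) by auto
    have "bracket (\<psi> (e j)) (e 1) = 0"
      using that(2) bracket_e1_top[of "2*n"] by (simp add: bracket_scale_left)
    moreover have "coord 0 (\<psi> (e 1)) = 0" using n_ge3 by (intro coord_0_psi_e) auto
    ultimately show ?thesis
      using psi_bracket[of "e j" "e 1"] coord_1_psi_e1 bracket_e_e1[OF that(1)] j(2)
      by (simp add: bracket_e_left[OF j(1)])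
  qed
  have "2 \<le> j" using assms by simp
  then show ?thesis using assms
  proof (induction j rule: dec_induct)
    case base
    then show ?case by (rule Suc[OF _ psi_e2])
  next
    case (step j)
    then have "\<psi> (e (Suc j)) = ((-1)^j / 2 * coord (2*n+1-j) (\<psi> (e 1))) *\<^sub>C e (2*n)"
      by (simp add: Suc_eq_plus1)
    then show ?case by (rule Suc[OF step.prems])
  qed
qed

text \<open>With \<open>j = 2 * n + 1 - k\<close>, the brackets \<open>[e 1, x]\<close> and \<open>[e (j + 1), x]\<close> both express
  \<open>coord (k - 1) (\<psi> x)\<close> as a multiple of \<open>coord k (\<psi> (e 1))\<close>, and the factors differ by \<open>1/2\<close>.\<close>

lemma coord_mid_zero:
  assumes "k \<in> {3..2*n-1}"
  shows "coord k (\<psi> (e 1)) = 0" "coord (k-1) (\<psi> x) = 0"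
proof -
  define j where "j = 2*n+1-k"
  define m where "m = coord k (\<psi> (e 1))"
  define p where "p = coord (k-1) (\<psi> x)"
  have j: "j \<in> {2..2*n-2}" "2*n+1-j = k" "j + 1 \<in> {2..2*n-1}" "2*n+1-(j+1) = k-1"
    using assms by (auto simp: j_def)
  have "of_nat (j + k) = (of_nat (2*n+1) :: complex)"
    using assms by (intro arg_cong[of _ _ of_nat]) (auto simp: j_def)
  then have jk: "of_nat j = 2 * of_nat n + 1 - (of_nat k :: complex)" by (simp add: algebra_simps)
  have eq1: "(2 + of_nat n - of_nat k) * m = - p"
    using coord_psi_e1_mid[OF assms] by (simp add: m_def p_def)
  have psi: "\<psi> (e (j+1)) = ((-1)^j / 2 * m) *\<^sub>C e (2*n)"
    using psi_e_Suc[OF j(1)] j(2) by (simp add: m_def)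
  have coords: "coord (2*n) (\<psi> (e (j+1))) = (-1)^j / 2 * m" "coord 1 (\<psi> (e (j+1))) = 0"
    unfolding psi using n_ge3 by (simp_all add: coord_e)
  have "2 * ((of_nat (j+1) - of_nat n) * ((-1)^j / 2 * m)) = (-1)^j / 2 * m + (-1)^(j+1) * p"
    using coord_psi_e[OF j(3), of "2*n"] n_ge3 unfolding j(4) p_def[symmetric]
    by (simp add: coord_bracket_x coords del: of_nat_add)
  then have "2 * ((2 * of_nat j + 1 - 2 * of_nat n) * m) = 2 * (- 2 * p)"
    by (cases "even j") (simp_all add: field_simps)
  then have eq2: "(2 * of_nat j + 1 - 2 * of_nat n) * m = - 2 * p" by (simp add: mult.commute)
  have "m = 2 * ((2 + of_nat n - of_nat k) * m) - (2 * of_nat j + 1 - 2 * of_nat n) * m"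
    unfolding jk by (simp add: algebra_simps)
  also have "\<dots> = 0" unfolding eq1 eq2 by simp
  finally have "m = 0" .
  with eq1 have "p = 0" by simp
  with \<open>m = 0\<close> show "coord k (\<psi> (e 1)) = 0" "coord (k-1) (\<psi> x) = 0" by (simp_all add: m_def p_def)
qed

lemma psi_e:
  assumes "i \<in> {1..2*n}" "i \<noteq> 2"
  shows "\<psi> (e i) = 0"
proof -
  consider "i = 1" | "i \<in> {3..2*n-1}" | "i = 2*n" using assms by force
  then show ?thesis
  proof cases
    case 1
    have "coord k (\<psi> (e 1)) = coord k 0" if k: "k \<le> 2*n" for k
    proof -
      consider "k = 0" | "k = 1" | "k = 2" | "k \<in> {3..2*n-1}" | "k = 2*n" using k by force
      then show ?thesis
        using coord_0_psi_e[OF assms(1)] 1 coord_1_psi_e1 coord_2_psi_e1 coord_2n_psi_e1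
          coord_mid_zero(1) by cases simp_all
    qed
    then show ?thesis unfolding 1 by (rule coord_eqI)
  next
    case 2
    then have "i - 1 \<in> {2..2*n-2}" "2*n+1-(i-1) \<in> {3..2*n-1}" by auto
    then show ?thesis using psi_e_Suc[of "i-1"] coord_mid_zero(1)[of "2*n+1-(i-1)"] 2 by simp
  next
    case 3
    then show ?thesis by (simp add: psi_e_2n)
  qed
qed

text \<open>The middle coordinates vanish by \<open>coord_mid_zero\<close> with its index shifted by
  one. The \<open>e (2*n)\<close>-coordinate stays free, as \<open>e (2*n)\<close> commutes with
  every \<open>e i\<close>.\<close>

lemma psi_x:
  "\<psi> x = ((3 - 2 * of_nat n) * coord (2*n) (\<psi> (e 2))) *\<^sub>C e (2*n-1) + coord (2*n) (\<psi> x) *\<^sub>C e (2*n)"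
proof (rule coord_eqI)
  fix k assume "k \<le> 2*n"
  then consider "k = 0" | "k = 1" | "k \<in> {2..2*n-2}" | "k = 2*n-1" | "k = 2*n" by force
  then show "coord k (\<psi> x) = coord k
    (((3 - 2 * of_nat n) * coord (2*n) (\<psi> (e 2))) *\<^sub>C e (2*n-1) + coord (2*n) (\<psi> x) *\<^sub>C e (2*n))"
  proof cases
    case 3
    then have "k \<le> 2*n" "k \<noteq> 2*n-1" "k \<noteq> 2*n" "k + 1 \<in> {3..2*n-1}" by auto
    then show ?thesis using coord_mid_zero(2)[of "k+1"] n_ge3 by (simp add: coord_e)
  qed (use n_ge3 coord_0_psi_x coord_1_psi_x coord_top_psi_x in \<open>auto simp: coord_e\<close>)
qed

end

section \<open>Reduction of the theorem to the normalized case\<close>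

theorem theorem2p6:
  fixes smul :: "complex \<Rightarrow> 'a::ab_group_add \<Rightarrow> 'a"
    and bracket :: "'a \<Rightarrow> 'a \<Rightarrow> 'a"
    and n :: nat and \<epsilon> :: complex
    and e :: "nat \<Rightarrow> 'a" and x :: 'a
    and \<phi> :: "'a \<Rightarrow> 'a"
  assumes "n \<ge> 3"
    and "\<epsilon> \<in> {-1, 1}"
    and "r_algebra smul bracket n \<epsilon> e x"
    and "half_derivation smul bracket \<phi>"
  shows "\<exists>a b c :: complex.
    (\<forall>i \<in> {1..2*n} - {2}. \<phi> (e i) = smul a (e i)) \<and>
    \<phi> (e 2) = smul a (e 2) + smul b (e (2*n)) \<and>
    \<phi> x = smul ((3 - 2 * of_nat n) * b) (e (2*n-1)) + smul c (e (2*n)) + smul a x"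
proof -
  interpret r_algebra_ge3 smul bracket n \<epsilon> e x
    using assms by (simp add: r_algebra_ge3_def r_algebra_ge3_axioms_def)
  have lin: "\<phi> (u + v) = \<phi> u + \<phi> v" "\<phi> (smul c u) = smul c (\<phi> u)"
    and half: "\<phi> (bracket u v) = smul (1/2) (bracket (\<phi> u) v + bracket u (\<phi> v))" for u v c
    using assms(4) by (simp_all add: half_derivation_def Vector_Spaces.linear_iff)
  \<comment> \<open>The only possible choice: the claimed form of \<open>\<phi> x\<close> has
    \<open>x\<close>-coordinate \<open>a\<close>.\<close>
  define a where "a = coord 0 (\<phi> x)"
  define \<psi> where "\<psi> u = \<phi> u - smul a u" for u
  have \<phi>: "\<phi> u = \<psi> u + smul a u" for u by (simp add: \<psi>_def)
  interpret normalized_half_derivation smul bracket n \<epsilon> e x \<psi>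
  proof
    have "\<psi> (bracket u v) = smul (1/2) (bracket (\<psi> u) v + bracket u (\<psi> v))" for u v
    proof -
      \<comment> \<open>The multiple \<open>a\<close> of the identity contributes \<open>a\<close>
        to each of the two brackets on the right, and the factor \<open>1/2\<close> turns their sum
        back into \<open>a\<close>, so both sides cancel it.\<close>
      have "\<psi> (bracket u v) + smul a (bracket u v)
          = smul (1/2) (bracket (\<psi> u) v + bracket u (\<psi> v)) + smul (1/2 * (a + a)) (bracket u v)"
        using half[of u v] unfolding \<phi> bracket_add_left bracket_add_right bracket_scale_left
          bracket_scale_right
        by (simp only: scale_scale[symmetric] scale_left_distrib scale_right_distrib add_ac)
      then show ?thesis by simp
    qed
    moreover have "Vector_Spaces.linear smul smul \<psi>"
      using vector_space_axioms
      by (simp add: Vector_Spaces.linear_iff \<psi>_def lin scale_right_distrib scale_right_diff_distrib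
          mult.commute)
    ultimately show "half_derivation smul bracket \<psi>" by (simp add: half_derivation_def)
    show "coord 0 (\<psi> x) = 0" by (simp add: \<psi>_def a_def coord_x)
  qed
  show ?thesis
  proof (intro exI conjI)
    show "\<forall>i \<in> {1..2*n} - {2}. \<phi> (e i) = smul a (e i)" by (simp add: \<phi> psi_e)
    show "\<phi> (e 2) = smul a (e 2) + smul (coord (2*n) (\<psi> (e 2))) (e (2*n))"
      unfolding \<phi> by (subst psi_e2) (rule add.commute)
    show "\<phi> x = smul ((3 - 2 * of_nat n) * coord (2*n) (\<psi> (e 2))) (e (2*n-1))
        + smul (coord (2*n) (\<psi> x)) (e (2*n)) + smul a x"
      unfolding \<phi> by (subst psi_x) (rule refl)
  qed
qed

end
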